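(* Let $p_1,\dots,p_m\in[n]$ be an insertion-only stream with frequency vectors $f^{(t)}\in\mathbb{Z}_{\ge 0}^n$, $t=0,1,\dots,m$. If $Z\in\{-1,1\}^n$ is drawn from a $4$-wise independent family, then \[\mathbb{E}\sup_{0\le t\le m}\left|\langle f^{(t)},Z\rangle\right| < 23\cdot\|f^{(m)}\|_2 .\]
   Context: An insertion-only stream is a list $p_1,\dots,p_m\in[n]$. The frequency vector at time $t$ is $f^{(t)}\in\mathbb{Z}_{\ge0}^n$ with $f^{(t)}_j=\#\{i\le t: p_i=j\}$ (so $f^{(0)}=0$). "$Z$ is drawn from a $4$-wise independent family" means each coordinate $Z_i$ is uniformly distributed on $\{-1,1\}$ and any $4$ distinct coordinates are mutually independent. *)

theory Defs
  imports "HOL-Probability.Probability"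
begin

definition freq :: "(nat \<Rightarrow> nat) \<Rightarrow> nat \<Rightarrow> nat \<Rightarrow> nat" where
  "freq p t j = card {i \<in> {1..t}. p i = j}"

(* Measurability into count_space {-1, 1} forces the values of Z i to lie in {-1, 1}
   everywhere on space M. For n < 4 there is no J with card J = 4, so only the
   uniform marginals are required in that case. *)
definition four_wise_indep_signs :: "'a measure \<Rightarrow> nat \<Rightarrow> (nat \<Rightarrow> 'a \<Rightarrow> real) \<Rightarrow> bool" where
  "four_wise_indep_signs M n Z \<longleftrightarrow>
     (\<forall>i\<in>{1..n}. Z i \<in> measurable M (count_space {-1, 1}) \<and>
        distr M (count_space {-1, 1}) (Z i) = uniform_count_measure {-1, 1}) \<and>
     (\<forall>J. J \<subseteq> {1..n} \<and> card J = 4 \<longrightarrow>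
        prob_space.indep_vars M (\<lambda>_. count_space {-1, 1}) Z J)"

end

theory Submission
  imports Defs
begin

text \<open>
  Put \<open>X\<^sub>t = \<langle>f\<^sup>t, Z\<rangle>\<close> and \<open>g t = \<parallel>f\<^sup>t\<parallel>\<^sup>2\<close>. Since the frequencies only grow,
  \<open>\<parallel>f\<^sup>t - f\<^sup>s\<parallel>\<^sup>2 \<le> g t - g s\<close>, so the fourth moment of an increment of \<open>X\<close> is at most
  \<open>9 (g t - g s)\<^sup>2\<close>. Since \<open>g\<close> is a monotone clock and the exponent 2 exceeds 1, a Billingsley
  bisection (cut the time interval where \<open>g\<close> has made half of its progress) bounds the fourth
  moment of the maximum by a multiple of \<open>(g m)\<^sup>2\<close>, and AM-GM turns this into a bound on the
  first moment.
\<close>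

section \<open>Maximal inequality from fourth moments of increments\<close>

text \<open>Convexity of the fourth power with weights 4/5 and 1/5, since
  \<open>a + d = 4/5 * (5/4 * a) + 1/5 * (5 * d)\<close>; proved by squaring twice. The weights make
  the coefficient of \<open>a^4\<close> less than 2, which lets the bisection recursion
  close.\<close>

lemma power4_add_le:
  fixes a d :: real
  shows "(a + d)^4 \<le> 125/64 * a^4 + 125 * d^4"
proof -
  have "(a + d)^2 \<le> 5/4 * a^2 + 5 * d^2"
    using zero_le_power2[of "a - 4 * d"] by (simp add: power2_eq_square algebra_simps)
  then have "((a + d)^2)^2 \<le> (5/4 * a^2 + 5 * d^2)^2"
    by (intro power_mono) auto
  also have "\<dots> \<le> 5/4 * (5/4 * a^2)^2 + 5 * (5 * d^2)^2"
    using zero_le_power2[of "5/4 * a^2 - 4 * (5 * d^2)"]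
    by (simp add: power2_eq_square algebra_simps)
  also have "\<dots> = 125/64 * a^4 + 125 * d^4"
    by (simp add: power2_eq_square power4_eq_xxxx)
  finally show ?thesis
    by simp
qed

context prob_space
begin

text \<open>The constant \<open>C = 16000/3\<close> solves \<open>C = 125/64 * (C/4 + C/4) + 125\<close>, the recursion coming from the
  bisection. The majorant \<open>W\<close> stands in for the maximum and avoids its measurability.\<close>

lemma fourth_moment_maximal:
  fixes X :: "nat \<Rightarrow> 'a \<Rightarrow> real" and g :: "nat \<Rightarrow> real" and K :: real
  assumes "K \<ge> 0"
    and mono: "\<And>s t. s \<le> t \<Longrightarrow> g s \<le> g t"
    and int: "\<And>s t. s \<le> t \<Longrightarrow> integrable M (\<lambda>\<omega>. (X t \<omega> - X s \<omega>)^4)"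
    and bound: "\<And>s t. s \<le> t \<Longrightarrow> expectation (\<lambda>\<omega>. (X t \<omega> - X s \<omega>)^4) \<le> K * (g t - g s)^2"
    and "s \<le> u"
  shows "\<exists>W. integrable M W \<and> (\<forall>\<omega>. \<forall>t\<in>{s..u}. (X t \<omega> - X s \<omega>)^4 \<le> W \<omega>) \<and>
             expectation W \<le> 16000/3 * K * (g u - g s)^2"
  using \<open>s \<le> u\<close>
proof (induction "u - s" arbitrary: s u rule: less_induct)
  case less
  show ?case
  proof (cases "u = s")
    case True
    then show ?thesis
      by (intro exI[of _ "\<lambda>_. 0"]) auto
  next
    case False
    define G where "G = g u - g s"
    \<comment> \<open>\<open>h\<close> is the first time after \<open>s\<close> by which
      \<open>g\<close> has made at least half of its progress. The strict \<open>s < h\<close> makes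
      the right piece shorter than the whole even when \<open>G = 0\<close>.\<close>
    define P where "P h \<longleftrightarrow> s < h \<and> G/2 \<le> g h - g s" for h
    define h where "h = (LEAST h. P h)"
    have "G \<ge> 0"
      using mono[OF less.prems] by (simp add: G_def)
    have "P u"
      using False less.prems \<open>G \<ge> 0\<close> by (simp add: P_def G_def)
    then have "P h" "h \<le> u"
      unfolding h_def by (rule LeastI, rule Least_le)
    then have sh: "s < h" and half: "G/2 \<le> g h - g s"
      by (auto simp: P_def)
    \<comment> \<open>Minimality of \<open>h\<close>. The left piece stops at \<open>h - 1\<close>
      because \<open>g\<close> may jump far past \<open>G/2\<close> at \<open>h\<close>; that jump
      is charged to the single increment \<open>D\<close>.\<close>
    have left: "g (h - 1) - g s \<le> G/2"
    proof (cases "h - 1 = s")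
      case False
      then show ?thesis
        using not_less_Least[of "h - 1" P] sh unfolding h_def[symmetric] by (auto simp: P_def)
    qed (use \<open>G \<ge> 0\<close> in simp)
    have right: "g u - g h \<le> G/2"
      using half by (simp add: G_def)
    have "h - 1 - s < u - s" "s \<le> h - 1"
      using sh \<open>h \<le> u\<close> by auto
    then obtain A where A: "integrable M A"
      "\<And>\<omega> t. t \<in> {s..h - 1} \<Longrightarrow> (X t \<omega> - X s \<omega>)^4 \<le> A \<omega>"
      "expectation A \<le> 16000/3 * K * (g (h - 1) - g s)^2"
      using less.hyps[of "h - 1" s] by blast
    have "u - h < u - s"
      using sh \<open>h \<le> u\<close> by auto
    then obtain B where B: "integrable M B"
      "\<And>\<omega> t. t \<in> {h..u} \<Longrightarrow> (X t \<omega> - X h \<omega>)^4 \<le> B \<omega>"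
      "expectation B \<le> 16000/3 * K * (g u - g h)^2"
      using less.hyps[of u h] \<open>h \<le> u\<close> by blast
    define D where "D = (\<lambda>\<omega>. (X h \<omega> - X s \<omega>)^4)"
    have D: "integrable M D" "expectation D \<le> K * (g h - g s)^2"
      using int[of s h] bound[of s h] sh by (auto simp: D_def)
    \<comment> \<open>Before \<open>h\<close> the majorant \<open>A\<close> suffices; from
      \<open>h\<close> on the increment is split at \<open>h\<close> into a part controlled by
      \<open>B\<close> and the part \<open>D\<close>. The sum \<open>A + B\<close> serves both
      cases.\<close>
    let ?W = "\<lambda>\<omega>. 125/64 * (A \<omega> + B \<omega>) + 125 * D \<omega>"
    have "(X t \<omega> - X s \<omega>)^4 \<le> ?W \<omega>" if "t \<in> {s..u}" for t \<omega>
    proof -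
      \<comment> \<open>The majorants are nonnegative because they dominate the zero increments at
        \<open>t = s\<close> and \<open>t = h\<close>.\<close>
      have nonneg: "A \<omega> \<ge> 0" "B \<omega> \<ge> 0" "D \<omega> \<ge> 0"
        using A(2)[of s \<omega>] B(2)[of h \<omega>] sh \<open>h \<le> u\<close> by (auto simp: D_def)
      show ?thesis
      proof (cases "t < h")
        case True
        then have "(X t \<omega> - X s \<omega>)^4 \<le> A \<omega>"
          using that by (intro A(2)) auto
        then show ?thesis
          using nonneg by argo
      next
        case False
        then have "(X t \<omega> - X h \<omega>)^4 \<le> B \<omega>"
          using that by (intro B(2)) auto
        moreover have "(X t \<omega> - X s \<omega>)^4 \<le> 125/64 * (X t \<omega> - X h \<omega>)^4 + 125 * D \<omega>"
          using power4_add_le[of "X t \<omega> - X h \<omega>" "X h \<omega> - X s \<omega>"] by (simp add: D_def)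
        ultimately show ?thesis
          using nonneg by argo
      qed
    qed
    moreover have "expectation ?W \<le> 16000/3 * K * G^2"
    proof -
      have "(g (h - 1) - g s)^2 \<le> (G/2)^2" "(g u - g h)^2 \<le> (G/2)^2" "(g h - g s)^2 \<le> G^2"
        using left right mono[of s "h - 1"] mono[of h u] mono[of s h] sh \<open>h \<le> u\<close>
        by (auto intro!: power_mono simp: G_def)
      from this[THEN mult_left_mono, OF \<open>K \<ge> 0\<close>]
      have "K * (g (h - 1) - g s)^2 \<le> K * G^2 / 4" "K * (g u - g h)^2 \<le> K * G^2 / 4"
        "K * (g h - g s)^2 \<le> K * G^2"
        by (simp_all add: power_divide)
      moreover have "expectation ?W = 125/64 * (expectation A + expectation B) + 125 * expectation D"
        using A(1) B(1) D(1) by simp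
      ultimately show ?thesis
        using A(3) B(3) D(2) by argo
    qed
    ultimately show ?thesis
      using A(1) B(1) D(1) by (intro exI[of _ ?W]) (auto simp: G_def)
  qed
qed

section \<open>Fourth moments of sums of signs\<close>

text \<open>Signs are added one at a time. In the expansion of the fourth power the odd powers of
  the new sign have mean zero and its square is 1, so only the fourth moment, \<open>6 * a^2\<close>
  times the second moment, and \<open>a^4\<close> remain.\<close>

lemma fourth_moment_sign_sum:
  fixes Z :: "nat \<Rightarrow> 'a \<Rightarrow> real" and v :: "nat \<Rightarrow> real"
  assumes "finite I"
    and meas: "\<And>i. i \<in> I \<Longrightarrow> Z i \<in> borel_measurable M"
    and signs: "\<And>i \<omega>. i \<in> I \<Longrightarrow> \<omega> \<in> space M \<Longrightarrow> \<bar>Z i \<omega>\<bar> = 1"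
    and zero: "\<And>K. K \<subseteq> I \<Longrightarrow> K \<noteq> {} \<Longrightarrow> card K \<le> 4 \<Longrightarrow> expectation (\<lambda>\<omega>. \<Prod>i\<in>K. Z i \<omega>) = 0"
  shows "expectation (\<lambda>\<omega>. (\<Sum>i\<in>I. v i * Z i \<omega>)^4) \<le> 3 * (\<Sum>i\<in>I. (v i)^2)^2"
proof -
  have sq: "Z i \<omega> * Z i \<omega> = 1" if "i \<in> I" "\<omega> \<in> space M" for i \<omega>
    using signs[OF that] abs_mult_self_eq[of "Z i \<omega>"] by simp
  have pair: "expectation (\<lambda>\<omega>. Z i \<omega> * Z k \<omega>) = 0" if "i \<in> I" "k \<in> I" "i \<noteq> k" for i k
    using zero[of "{i, k}"] that by (simp add: card_insert_if)
  \<comment> \<open>Two equal indices among \<open>i\<close>, \<open>j\<close>, \<open>l\<close>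
    cancel because signs square to 1, which leaves a product of two distinct signs; otherwise all
    four indices are distinct.\<close>
  have quad: "expectation (\<lambda>\<omega>. Z i \<omega> * Z j \<omega> * Z l \<omega> * Z k \<omega>) = 0"
    if "i \<in> I" "j \<in> I" "l \<in> I" "k \<in> I" "i \<noteq> k" "j \<noteq> k" "l \<noteq> k" for i j l k
  proof -
    consider "i = j" | "i = l" | "j = l" | "i \<noteq> j" "i \<noteq> l" "j \<noteq> l"
      by blast
    then show ?thesis
    proof cases
      case 1
      have "expectation (\<lambda>\<omega>. Z i \<omega> * Z j \<omega> * Z l \<omega> * Z k \<omega>) = expectation (\<lambda>\<omega>. Z l \<omega> * Z k \<omega>)"
        using 1 that by (intro Bochner_Integration.integral_cong) (auto simp: sq)
      then show ?thesis
        using pair that by simp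
    next
      case 2
      have "expectation (\<lambda>\<omega>. Z i \<omega> * Z j \<omega> * Z l \<omega> * Z k \<omega>) = expectation (\<lambda>\<omega>. Z j \<omega> * Z k \<omega>)"
        using 2 that by (intro Bochner_Integration.integral_cong) (auto simp: sq mult.commute mult.left_commute)
      then show ?thesis
        using pair that by simp
    next
      case 3
      have "expectation (\<lambda>\<omega>. Z i \<omega> * Z j \<omega> * Z l \<omega> * Z k \<omega>) = expectation (\<lambda>\<omega>. Z i \<omega> * Z k \<omega>)"
        using 3 that by (intro Bochner_Integration.integral_cong) (auto simp: sq mult.assoc)
      then show ?thesis
        using pair that by simp
    next
      case 4
      then show ?thesis
        using zero[of "{i, j, l, k}"] that by (simp add: card_insert_if mult.assoc)
    qed
  qed
  define S where "S F \<omega> = (\<Sum>i\<in>F. v i * Z i \<omega>)" for F \<omega>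
  \<comment> \<open>One boundedness argument covers every term of the binomial expansions;
    \<open>r = 0\<close> gives the pure powers of \<open>S F\<close>.\<close>
  have int: "integrable M (\<lambda>\<omega>. S F \<omega> ^ q * Z k \<omega> ^ r)" if "F \<subseteq> I" "k \<in> I" for F k q r
  proof (rule integrable_const_bound[where B = "(\<Sum>i\<in>F. \<bar>v i\<bar>) ^ q"])
    show "AE \<omega> in M. norm (S F \<omega> ^ q * Z k \<omega> ^ r) \<le> (\<Sum>i\<in>F. \<bar>v i\<bar>) ^ q"
    proof (intro AE_I2)
      fix \<omega> assume "\<omega> \<in> space M"
      have "\<bar>S F \<omega>\<bar> \<le> (\<Sum>i\<in>F. \<bar>v i * Z i \<omega>\<bar>)"
        unfolding S_def by (rule sum_abs)
      also have "\<dots> = (\<Sum>i\<in>F. \<bar>v i\<bar>)"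
        using that \<open>\<omega> \<in> space M\<close> by (intro sum.cong) (auto simp: abs_mult signs)
      finally show "norm (S F \<omega> ^ q * Z k \<omega> ^ r) \<le> (\<Sum>i\<in>F. \<bar>v i\<bar>) ^ q"
        using that \<open>\<omega> \<in> space M\<close> by (simp add: abs_mult power_abs signs power_mono)
    qed
    have "S F \<in> borel_measurable M"
      unfolding S_def using meas that by (intro borel_measurable_sum) auto
    then show "(\<lambda>\<omega>. S F \<omega> ^ q * Z k \<omega> ^ r) \<in> borel_measurable M"
      using meas[of k] that by simp
  qed
  have intprod: "integrable M (\<lambda>\<omega>. Z i \<omega> * Z j \<omega> * Z l \<omega> * Z k \<omega>)" "integrable M (\<lambda>\<omega>. Z i \<omega> * Z k \<omega>)"
    if "i \<in> I" "j \<in> I" "l \<in> I" "k \<in> I" for i j l k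
    using meas that by (auto intro!: integrable_const_bound[where B = 1] AE_I2 simp: abs_mult signs)
  \<comment> \<open>The second moment is carried through the induction because it appears in the
    expansion of the fourth.\<close>
  have "expectation (\<lambda>\<omega>. S F \<omega> ^ 2) = (\<Sum>i\<in>F. (v i)^2) \<and>
        expectation (\<lambda>\<omega>. S F \<omega> ^ 4) \<le> 3 * (\<Sum>i\<in>F. (v i)^2)^2" if "F \<subseteq> I" for F
    using finite_subset[OF that \<open>finite I\<close>] that
  proof (induction F rule: finite_induct)
    case empty
    then show ?case
      by (simp add: S_def)
  next
    case (insert k F)
    then have F: "F \<subseteq> I" and k: "k \<in> I" "k \<notin> F"
      by auto
    have S1: "expectation (\<lambda>\<omega>. S F \<omega> * Z k \<omega>) = 0"
    proof -
      have "expectation (\<lambda>\<omega>. S F \<omega> * Z k \<omega>) = expectation (\<lambda>\<omega>. \<Sum>i\<in>F. v i * (Z i \<omega> * Z k \<omega>))"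
        by (simp add: S_def sum_distrib_right mult.assoc)
      also have "\<dots> = (\<Sum>i\<in>F. v i * expectation (\<lambda>\<omega>. Z i \<omega> * Z k \<omega>))"
        using F k intprod(2) by (subst Bochner_Integration.integral_sum) auto
      also have "\<dots> = 0"
        using F k by (intro sum.neutral ballI) (auto intro!: pair)
      finally show ?thesis .
    qed
    \<comment> \<open>Every index in the expanded cube lies in \<open>F\<close> and so differs from
      \<open>k\<close>, which is what \<open>quad\<close> requires.\<close>
    have S3: "expectation (\<lambda>\<omega>. S F \<omega> ^ 3 * Z k \<omega>) = 0"
    proof -
      have "S F \<omega> ^ 3 * Z k \<omega> =
          (\<Sum>i\<in>F. \<Sum>j\<in>F. \<Sum>l\<in>F. v i * v j * v l * (Z i \<omega> * Z j \<omega> * Z l \<omega> * Z k \<omega>))" for \<omega>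
        unfolding S_def power3_eq_cube by (simp add: sum_distrib_left mult_ac)
      then have "expectation (\<lambda>\<omega>. S F \<omega> ^ 3 * Z k \<omega>) = expectation (\<lambda>\<omega>.
          \<Sum>i\<in>F. \<Sum>j\<in>F. \<Sum>l\<in>F. v i * v j * v l * (Z i \<omega> * Z j \<omega> * Z l \<omega> * Z k \<omega>))"
        by simp
      also have "\<dots> = (\<Sum>i\<in>F. \<Sum>j\<in>F. \<Sum>l\<in>F.
          v i * v j * v l * expectation (\<lambda>\<omega>. Z i \<omega> * Z j \<omega> * Z l \<omega> * Z k \<omega>))"
      proof -
        have "integrable M (\<lambda>\<omega>. v i * v j * v l * (Z i \<omega> * Z j \<omega> * Z l \<omega> * Z k \<omega>))"
          if "i \<in> F" "j \<in> F" "l \<in> F" for i j l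
          using F k that by (intro integrable_mult_right intprod(1)) auto
        then show ?thesis
          by (simp add: Bochner_Integration.integral_sum Bochner_Integration.integrable_sum)
      qed
      also have "\<dots> = 0"
      proof (intro sum.neutral ballI)
        fix i j l assume "i \<in> F" "j \<in> F" "l \<in> F"
        then show "v i * v j * v l * expectation (\<lambda>\<omega>. Z i \<omega> * Z j \<omega> * Z l \<omega> * Z k \<omega>) = 0"
          using quad[of i j l k] F k by auto
      qed
      finally show ?thesis .
    qed
    define a where "a = v k"
    define \<sigma> where "\<sigma> = (\<Sum>i\<in>F. (v i)^2)"
    have IH: "expectation (\<lambda>\<omega>. S F \<omega> ^ 2) = \<sigma>" "expectation (\<lambda>\<omega>. S F \<omega> ^ 4) \<le> 3 * \<sigma>^2"
      using insert.IH[OF F] by (auto simp: \<sigma>_def)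
    have step: "S (insert k F) \<omega> = S F \<omega> + a * Z k \<omega>" for \<omega>
      using insert.hyps by (simp add: S_def a_def)
    have sumi: "(\<Sum>i\<in>insert k F. (v i)^2) = \<sigma> + a^2"
      using insert.hyps by (simp add: \<sigma>_def a_def)
    have ints: "integrable M (\<lambda>\<omega>. S F \<omega> ^ 2)" "integrable M (\<lambda>\<omega>. S F \<omega> ^ 4)"
        "integrable M (\<lambda>\<omega>. S F \<omega> ^ 3 * Z k \<omega>)" "integrable M (\<lambda>\<omega>. S F \<omega> * Z k \<omega>)"
      using int[OF F k(1), of 2 0] int[OF F k(1), of 4 0] int[OF F k(1), of 3 1]
        int[OF F k(1), of 1 1] by simp_all
    have "expectation (\<lambda>\<omega>. S (insert k F) \<omega> ^ 2) =
        expectation (\<lambda>\<omega>. S F \<omega> ^ 2 + 2 * a * (S F \<omega> * Z k \<omega>) + a^2)"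
    proof (intro Bochner_Integration.integral_cong refl)
      fix \<omega> assume "\<omega> \<in> space M"
      then have z: "Z k \<omega> ^ 2 = 1"
        using sq k by (simp add: power2_eq_square)
      have "(x + a * z)^2 = x^2 + 2 * a * (x * z) + a^2 * z^2" for x z :: real
        by (simp add: power2_eq_square algebra_simps)
      from this[of "S F \<omega>" "Z k \<omega>"]
      show "S (insert k F) \<omega> ^ 2 = S F \<omega> ^ 2 + 2 * a * (S F \<omega> * Z k \<omega>) + a^2"
        by (simp add: step z)
    qed
    also have "\<dots> = \<sigma> + a^2"
      using ints S1 IH by (simp add: prob_space)
    finally have second: "expectation (\<lambda>\<omega>. S (insert k F) \<omega> ^ 2) = \<sigma> + a^2" .
    have "expectation (\<lambda>\<omega>. S (insert k F) \<omega> ^ 4) =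
        expectation (\<lambda>\<omega>. S F \<omega> ^ 4 + 4 * a * (S F \<omega> ^ 3 * Z k \<omega>) + 6 * a^2 * S F \<omega> ^ 2
          + 4 * a^3 * (S F \<omega> * Z k \<omega>) + a^4)"
    proof (intro Bochner_Integration.integral_cong refl)
      fix \<omega> assume "\<omega> \<in> space M"
      then have z: "Z k \<omega> ^ 2 = 1"
        using sq k by (simp add: power2_eq_square)
      have "(x + a * z)^4 = x^4 + 4 * a * (x^3 * z) + 6 * a^2 * x^2 * z^2
          + 4 * a^3 * (x * z) * z^2 + a^4 * (z^2)^2" for x z :: real
        by (simp add: power2_eq_square power3_eq_cube power4_eq_xxxx algebra_simps)
      from this[of "S F \<omega>" "Z k \<omega>"]
      show "S (insert k F) \<omega> ^ 4 = S F \<omega> ^ 4 + 4 * a * (S F \<omega> ^ 3 * Z k \<omega>) + 6 * a^2 * S F \<omega> ^ 2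
          + 4 * a^3 * (S F \<omega> * Z k \<omega>) + a^4"
        by (simp add: step z)
    qed
    also have "\<dots> = expectation (\<lambda>\<omega>. S F \<omega> ^ 4) + 6 * a^2 * \<sigma> + a^4"
      using ints S1 S3 IH by (simp add: prob_space)
    \<comment> \<open>After the induction hypothesis the slack is exactly
      \<open>2 * a^4\<close>.\<close>
    also have "\<dots> \<le> 3 * (\<sigma> + a^2)^2"
      using IH(2) zero_le_power2[of "a^2"] by (simp add: power2_eq_square power4_eq_xxxx algebra_simps)
    finally show ?case
      using second sumi by simp
  qed
  from this[of I] show ?thesis
    by (simp add: S_def)
qed

text \<open>As \<open>n \<ge> 4\<close>, the set \<open>K\<close> extends to a four-element index
  set, on which the signs are independent. Independence passes down to \<open>K\<close>, so the
  expectation factors into means, each of them zero.\<close>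

lemma four_wise_indep_signs_prod_expectation:
  assumes "four_wise_indep_signs M n Z" "n \<ge> 4" "K \<subseteq> {1..n}" "K \<noteq> {}" "card K \<le> 4"
  shows "expectation (\<lambda>\<omega>. \<Prod>i\<in>K. Z i \<omega>) = 0"
proof -
  have meas: "Z i \<in> measurable M (count_space {-1, 1})"
    and unif: "distr M (count_space {-1, 1}) (Z i) = uniform_count_measure {-1, 1}"
    if "i \<in> {1..n}" for i
    using assms(1) that by (auto simp: four_wise_indep_signs_def)
  have mean: "expectation (Z i) = 0" if "i \<in> {1..n}" for i
  proof -
    have "expectation (Z i) = (\<integral>x. x \<partial>distr M (count_space {-1, 1}) (Z i))"
      using meas[OF that] by (subst integral_distr) auto
    also have "\<dots> = 0"
      unfolding unif[OF that] by (subst integral_uniform_count_measure) auto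
    finally show ?thesis .
  qed
  obtain J where J: "K \<subseteq> J" "J \<subseteq> {1..n}" "card J = 4"
    using exists_subset_between[of K 4 "{1..n}"] assms by auto
  then have "indep_vars (\<lambda>_. count_space {-1, 1}) Z J"
    using assms(1) by (auto simp: four_wise_indep_signs_def)
  then have "indep_vars (\<lambda>_. count_space {-1, 1}) Z K"
    using J(1) by (rule indep_vars_subset)
  \<comment> \<open>The factorization of expectations is stated for Borel variables, so the target
    space is changed through the identity map.\<close>
  then have indep: "indep_vars (\<lambda>_. borel) Z K"
    by (rule indep_vars_compose2[where Y = "\<lambda>_ x. x"]) auto
  have "finite K"
    using assms(3) finite_subset by blast
  have "integrable M (Z i)" if "i \<in> K" for i
  proof (rule integrable_const_bound[where B = 1])
    show "AE \<omega> in M. norm (Z i \<omega>) \<le> 1"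
      using measurable_space[OF meas[of i]] that assms(3) by (intro AE_I2) fastforce
    show "Z i \<in> borel_measurable M"
      using indep that by (auto simp: indep_vars_def)
  qed
  then have "expectation (\<lambda>\<omega>. \<Prod>i\<in>K. Z i \<omega>) = (\<Prod>i\<in>K. expectation (Z i))"
    using indep_vars_lebesgue_integral[OF \<open>finite K\<close> indep] by simp
  also have "\<dots> = 0"
  proof -
    obtain i where "i \<in> K"
      using assms(4) by blast
    then show ?thesis
      using mean[of i] assms(3) \<open>finite K\<close> by (intro prod_zero bexI[of _ i]) auto
  qed
  finally show ?thesis .
qed

text \<open>Below four coordinates no independence is assumed; Cauchy-Schwarz gives the constant
  \<open>3\<^sup>2\<close>, which is attained for three fully dependent signs.\<close>

lemma four_wise_indep_signs_fourth_moment: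
  assumes Z: "four_wise_indep_signs M n Z"
  shows "integrable M (\<lambda>\<omega>. (\<Sum>i=1..n. v i * Z i \<omega>)^4)"
    and "expectation (\<lambda>\<omega>. (\<Sum>i=1..n. v i * Z i \<omega>)^4) \<le> 9 * (\<Sum>i=1..n. (v i)^2)^2"
proof -
  have count: "Z i \<in> measurable M (count_space {-1, 1})" if "i \<in> {1..n}" for i
    using Z that by (auto simp: four_wise_indep_signs_def)
  have meas: "Z i \<in> borel_measurable M" if "i \<in> {1..n}" for i
    using measurable_compose[OF count[OF that], of "\<lambda>x. x" borel] by simp
  have signs: "\<bar>Z i \<omega>\<bar> = 1" if "i \<in> {1..n}" "\<omega> \<in> space M" for i \<omega>
    using measurable_space[OF count[OF that(1)] that(2)] by auto
  let ?S = "\<lambda>\<omega>. (\<Sum>i=1..n. v i * Z i \<omega>)" and ?\<sigma> = "\<Sum>i=1..n. (v i)^2"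
  \<comment> \<open>The squares of the signs sum to \<open>n\<close>. This pointwise bound yields
    integrability for every \<open>n\<close> and the moment bound for
    \<open>n \<le> 3\<close>.\<close>
  have CS: "?S \<omega> ^ 4 \<le> (real n)^2 * ?\<sigma>^2" if "\<omega> \<in> space M" for \<omega>
  proof -
    have "(Z i \<omega>)^2 = 1" if "i \<in> {1..n}" for i
      using signs[OF that \<open>\<omega> \<in> space M\<close>] power2_abs[of "Z i \<omega>"] by simp
    then have "?S \<omega> ^ 2 \<le> ?\<sigma> * real n"
      using Cauchy_Schwarz_ineq_sum[of v "\<lambda>i. Z i \<omega>" "{1..n}"] by simp
    then have "(?S \<omega> ^ 2)^2 \<le> (?\<sigma> * real n)^2"
      by (intro power_mono) auto
    then show ?thesis
      by (simp add: power_mult_distrib mult.commute flip: power_mult)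
  qed
  show int: "integrable M (\<lambda>\<omega>. ?S \<omega> ^ 4)"
    using CS meas by (intro integrable_const_bound[where B = "(real n)^2 * ?\<sigma>^2"]) auto
  show "expectation (\<lambda>\<omega>. ?S \<omega> ^ 4) \<le> 9 * ?\<sigma>^2"
  proof (cases "n \<ge> 4")
    case True
    have "expectation (\<lambda>\<omega>. ?S \<omega> ^ 4) \<le> 3 * ?\<sigma>^2"
      using meas signs four_wise_indep_signs_prod_expectation[OF Z True]
      by (intro fourth_moment_sign_sum) auto
    also have "\<dots> \<le> 9 * ?\<sigma>^2"
      by simp
    finally show ?thesis .
  next
    case False
    have "expectation (\<lambda>\<omega>. ?S \<omega> ^ 4) \<le> expectation (\<lambda>_. (real n)^2 * ?\<sigma>^2)"
      using int CS by (intro integral_mono) auto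
    also have "\<dots> = (real n)^2 * ?\<sigma>^2"
      by (simp add: prob_space)
    also have "(real n)^2 \<le> 3^2"
      using False by (intro power_mono) auto
    finally show ?thesis
      by (simp add: mult_right_mono)
  qed
qed

end

section \<open>Application to insertion-only streams\<close>

lemma freq_mono: "s \<le> t \<Longrightarrow> freq p s j \<le> freq p t j"
  unfolding freq_def by (intro card_mono) auto

text \<open>AM-GM for \<open>y^4\<close> and three copies of \<open>c^4\<close>, with equality at
  \<open>y = c\<close>; an explicit sum of squares makes it valid for every real
  \<open>y\<close>.\<close>

lemma le_fourth_power:
  fixes y c :: real
  assumes "c > 0"
  shows "y \<le> (y^4 / c^3 + 3 * c) / 4"
proof -
  have "4 * y * c^3 \<le> y^4 + 3 * c^4"
  proof -
    have "y^4 + 3 * c^4 - 4 * y * c^3 = (y^2 - c^2)^2 + 2 * (c * (y - c))^2"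
      by (simp add: power2_eq_square power3_eq_cube power4_eq_xxxx algebra_simps)
    moreover have "\<dots> \<ge> 0"
      by simp
    ultimately show ?thesis
      by linarith
  qed
  then have "y \<le> (y^4 + 3 * c^4) / (4 * c^3)"
    using assms by (subst pos_le_divide_eq) (auto simp: mult_ac)
  also have "\<dots> = (y^4 / c^3 + 3 * c) / 4"
    using assms by (simp add: add_divide_distrib power3_eq_cube power4_eq_xxxx)
  finally show ?thesis .
qed

theorem theorem1:
  fixes M :: "'a measure" and Z :: "nat \<Rightarrow> 'a \<Rightarrow> real"
    and p :: "nat \<Rightarrow> nat" and n m :: nat
  assumes "prob_space M"
    and "m \<ge> 1"
    and "\<forall>i\<in>{1..m}. p i \<in> {1..n}"
    and "four_wise_indep_signs M n Z"
  shows "prob_space.expectation M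
           (\<lambda>\<omega>. SUP t\<in>{0..m}. \<bar>\<Sum>j=1..n. real (freq p t j) * Z j \<omega>\<bar>)
         < 23 * L2_set (\<lambda>j. real (freq p m j)) {1..n}"
proof -
  interpret prob_space M by fact
  define X where "X t \<omega> = (\<Sum>j=1..n. real (freq p t j) * Z j \<omega>)" for t \<omega>
  define g where "g t = (\<Sum>j=1..n. (real (freq p t j))^2)" for t
  define L where "L = L2_set (\<lambda>j. real (freq p m j)) {1..n}"
  have incr: "X t \<omega> - X s \<omega> = (\<Sum>j=1..n. (real (freq p t j) - real (freq p s j)) * Z j \<omega>)" for s t \<omega>
    by (simp add: X_def sum_subtractf left_diff_distrib)
  have g_mono: "g s \<le> g t" if "s \<le> t" for s t
    unfolding g_def using that by (intro sum_mono power_mono) (auto intro: freq_mono)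
  \<comment> \<open>Monotone frequencies enter here: for \<open>0 \<le> y \<le> x\<close> the two
    sides differ by \<open>2 * y * (x - y) \<ge> 0\<close>.\<close>
  have g_incr: "(\<Sum>j=1..n. (real (freq p t j) - real (freq p s j))^2) \<le> g t - g s" if "s \<le> t" for s t
  proof -
    have "(x - y)^2 \<le> x^2 - y^2" if "0 \<le> y" "y \<le> x" for x y :: real
      using mult_nonneg_nonneg[of "2 * y" "x - y"] that by (simp add: power2_eq_square algebra_simps)
    then show ?thesis
      unfolding g_def sum_subtractf[symmetric]
      using that by (intro sum_mono) (simp add: freq_mono)
  qed
  have X_int: "integrable M (\<lambda>\<omega>. (X t \<omega> - X s \<omega>)^4)" for s t
    unfolding incr by (rule four_wise_indep_signs_fourth_moment(1)[OF assms(4)])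
  have X_bound: "expectation (\<lambda>\<omega>. (X t \<omega> - X s \<omega>)^4) \<le> 9 * (g t - g s)^2" if "s \<le> t" for s t
  proof -
    have "expectation (\<lambda>\<omega>. (X t \<omega> - X s \<omega>)^4)
        \<le> 9 * (\<Sum>j=1..n. (real (freq p t j) - real (freq p s j))^2)^2"
      unfolding incr by (rule four_wise_indep_signs_fourth_moment(2)[OF assms(4)])
    also have "\<dots> \<le> 9 * (g t - g s)^2"
      using g_incr[OF that] by (intro mult_left_mono power_mono sum_nonneg) auto
    finally show ?thesis .
  qed
  obtain W where W: "integrable M W" "\<And>\<omega> t. t \<in> {0..m} \<Longrightarrow> (X t \<omega> - X 0 \<omega>)^4 \<le> W \<omega>"
      "expectation W \<le> 16000/3 * 9 * (g m - g 0)^2"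
    using fourth_moment_maximal[of 9 g X 0 m] g_mono X_int X_bound by auto
  have "freq p 0 j = 0" for j
    by (simp add: freq_def)
  then have "X 0 \<omega> = 0" "g 0 = 0" for \<omega>
    by (simp_all add: X_def g_def)
  have "g m = L^2"
    by (simp add: g_def L_def L2_set_def sum_nonneg)
  \<comment> \<open>Positivity makes the final inequality strict; the first stream item has positive
    frequency at time \<open>m\<close>.\<close>
  have "L > 0"
  proof -
    have "1 \<in> {i \<in> {1..m}. p i = p 1}"
      using assms(2) by simp
    then have "freq p m (p 1) > 0"
      unfolding freq_def by (subst card_gt_0_iff) auto
    moreover have "p 1 \<in> {1..n}"
      using assms(2,3) by simp
    ultimately have "real (freq p m (p 1)) \<le> L"
      unfolding L_def by (intro member_le_L2_set) auto
    then show ?thesis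
      using \<open>freq p m (p 1) > 0\<close> by linarith
  qed
  \<comment> \<open>The bound \<open>(48000 * L^4 / c^3 + 3 * c) / 4\<close>, where
    \<open>48000 = 16000/3 * 9\<close>, is minimal at \<open>c = 48000^(1/4) * L\<close>, about
    \<open>14.8 * L\<close>; 15 is a convenient nearby value.\<close>
  define c where "c = 15 * L"
  have "c > 0"
    using \<open>L > 0\<close> by (simp add: c_def)
  have sup: "0 \<le> (W \<omega> / c^3 + 3 * c) / 4" "(SUP t\<in>{0..m}. \<bar>X t \<omega>\<bar>) \<le> (W \<omega> / c^3 + 3 * c) / 4" for \<omega>
  proof -
    have *: "\<bar>X t \<omega>\<bar> \<le> (W \<omega> / c^3 + 3 * c) / 4" if "t \<in> {0..m}" for t
    proof -
      have "\<bar>X t \<omega>\<bar> \<le> (\<bar>X t \<omega>\<bar>^4 / c^3 + 3 * c) / 4"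
        by (rule le_fourth_power[OF \<open>c > 0\<close>])
      also have "\<bar>X t \<omega>\<bar>^4 / c^3 \<le> W \<omega> / c^3"
        using W(2)[OF that, of \<omega>] \<open>X 0 \<omega> = 0\<close> \<open>c > 0\<close>
        by (intro divide_right_mono) (auto simp: power_even_abs)
      finally show ?thesis
        by simp
    qed
    then show "(SUP t\<in>{0..m}. \<bar>X t \<omega>\<bar>) \<le> (W \<omega> / c^3 + 3 * c) / 4"
      by (intro cSUP_least) auto
    show "0 \<le> (W \<omega> / c^3 + 3 * c) / 4"
      using *[of 0] by simp
  qed
  \<comment> \<open>\<open>integral_mono'\<close> asks for a nonnegative integrable majorant and
    nothing of the supremum: the integral of a non-integrable function is 0 by default.\<close>
  have "expectation (\<lambda>\<omega>. SUP t\<in>{0..m}. \<bar>X t \<omega>\<bar>) \<le> expectation (\<lambda>\<omega>. (W \<omega> / c^3 + 3 * c) / 4)"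
    using W(1) sup by (intro integral_mono') auto
  also have "\<dots> = (expectation W / c^3 + 3 * c) / 4"
    using W(1) by (simp add: prob_space)
  also have "\<dots> \<le> (48000 * L^4 / c^3 + 3 * c) / 4"
    using W(3) \<open>c > 0\<close> \<open>g m = L^2\<close> \<open>g 0 = 0\<close>
    by (intro divide_right_mono add_right_mono) (auto simp flip: power_mult)
  also have "\<dots> = (48000 / 3375 + 45) / 4 * L"
    using \<open>L > 0\<close> by (simp add: c_def power3_eq_cube power4_eq_xxxx field_simps)
  also have "\<dots> < 23 * L"
    using \<open>L > 0\<close> by simp
  finally show ?thesis
    by (simp add: X_def L_def)
qed

end
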